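(* Let $G$ be a simple connected graph of diameter $D$ and edge metric dimension $k$. Then $$|E(G)| \leq \left(\left\lfloor \tfrac{2D}{3}\right\rfloor +1\right)^{k}+k \sum_{i = 1}^{\lceil D/3\rceil } (2i)^{k-1}.$$
   Context: All graphs are simple and connected. For vertices $u,v$ of a graph $G$, $d(u,v)$ is their distance in $G$; the diameter is the maximum distance between two vertices. For an edge $e=\{x,y\}$ and a vertex $v$, let $d(e,v)=\min(d(x,v),d(y,v))$. A set $S\subset V(G)$ is a resolving set for the edges of $G$ if no two distinct edges $e,f$ satisfy $d(e,s)=d(f,s)$ for all $s\in S$. The edge metric dimension $\operatorname{edim}(G)$ is the minimum size of a resolving set for the edges of $G$. *)

theory Defs
  imports Complex_Main
begin

text \<open>A graph is given by its vertex set \<open>V\<close> and its set \<open>E\<close> of edges, an edge being a two-element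
  set of vertices. As usual, graphs are finite with at least one vertex.\<close>

definition simple_graph :: "'a set \<Rightarrow> 'a set set \<Rightarrow> bool" where
  "simple_graph V E \<longleftrightarrow> finite V \<and> V \<noteq> {} \<and> (\<forall>e\<in>E. e \<subseteq> V \<and> card e = 2)"

definition adj :: "'a set set \<Rightarrow> 'a rel" where
  "adj E = {(u, v). {u, v} \<in> E}"

definition connected_graph :: "'a set \<Rightarrow> 'a set set \<Rightarrow> bool" where
  "connected_graph V E \<longleftrightarrow> (\<forall>u\<in>V. \<forall>v\<in>V. (u, v) \<in> (adj E)\<^sup>*)"

text \<open>\<open>(u, v) \<in> adj E ^^ n\<close> says that there is a walk of length \<open>n\<close> from \<open>u\<close> to \<open>v\<close>. The value of
  \<open>graph_dist\<close> is only meaningful for vertices in the same component.\<close>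

definition graph_dist :: "'a set set \<Rightarrow> 'a \<Rightarrow> 'a \<Rightarrow> nat" where
  "graph_dist E u v = (LEAST n. (u, v) \<in> adj E ^^ n)"

definition graph_diameter :: "'a set \<Rightarrow> 'a set set \<Rightarrow> nat" where
  "graph_diameter V E = Max {graph_dist E u v |u v. u \<in> V \<and> v \<in> V}"

text \<open>For \<open>e = {x, y}\<close> this is \<open>min (graph_dist E x v) (graph_dist E y v)\<close>.\<close>

definition edge_dist :: "'a set set \<Rightarrow> 'a set \<Rightarrow> 'a \<Rightarrow> nat" where
  "edge_dist E e v = Min ((\<lambda>x. graph_dist E x v) ` e)"

definition edge_resolving_set :: "'a set \<Rightarrow> 'a set set \<Rightarrow> 'a set \<Rightarrow> bool" where
  "edge_resolving_set V E S \<longleftrightarrow> S \<subseteq> V \<and>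
     \<not> (\<exists>e\<in>E. \<exists>f\<in>E. e \<noteq> f \<and> (\<forall>s\<in>S. edge_dist E e s = edge_dist E f s))"

definition edge_metric_dimension :: "'a set \<Rightarrow> 'a set set \<Rightarrow> nat" where
  "edge_metric_dimension V E = Min {card S |S. edge_resolving_set V E S}"

text \<open>The minimum defining \<open>edge_metric_dimension\<close> is over a finite nonempty set: in a
  connected simple graph \<open>V\<close> itself is resolving, because the edge \<open>{x, y}\<close> is the only edge at
  distance \<open>0\<close> from both \<open>x\<close> and \<open>y\<close>.\<close>

lemma graph_dist_eq_0_iff:
  assumes "connected_graph V E" "u \<in> V" "v \<in> V"
  shows "graph_dist E u v = 0 \<longleftrightarrow> u = v"
proof -
  obtain n where "(u, v) \<in> adj E ^^ n"
    using assms unfolding connected_graph_def by (meson rtrancl_imp_relpow)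
  then have "(u, v) \<in> adj E ^^ graph_dist E u v"
    unfolding graph_dist_def by (rule LeastI)
  moreover have "graph_dist E u u = 0"
    unfolding graph_dist_def by (rule Least_eq_0) simp
  ultimately show ?thesis by auto
qed

lemma edge_dist_eq_0_iff:
  assumes "simple_graph V E" "connected_graph V E" "e \<in> E" "v \<in> V"
  shows "edge_dist E e v = 0 \<longleftrightarrow> v \<in> e"
proof -
  have e: "e \<subseteq> V" "finite e" "e \<noteq> {}"
    using assms by (auto simp: simple_graph_def intro: card_ge_0_finite)
  have "edge_dist E e v = 0 \<longleftrightarrow> 0 \<in> (\<lambda>x. graph_dist E x v) ` e"
    unfolding edge_dist_def using e by (subst Min_eq_iff) auto
  also have "\<dots> \<longleftrightarrow> (\<exists>x\<in>e. graph_dist E x v = 0)" by force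
  also have "\<dots> \<longleftrightarrow> v \<in> e"
    using e assms graph_dist_eq_0_iff[OF assms(2)] by blast
  finally show ?thesis .
qed

lemma edge_resolving_set_vertices:
  assumes "simple_graph V E" "connected_graph V E"
  shows "edge_resolving_set V E V"
proof -
  have "e = f" if "e \<in> E" "f \<in> E" "\<forall>s\<in>V. edge_dist E e s = edge_dist E f s" for e f
  proof -
    have "s \<in> e \<longleftrightarrow> s \<in> f" if "s \<in> V" for s
      using edge_dist_eq_0_iff[OF assms] that \<open>e \<in> E\<close> \<open>f \<in> E\<close>
        \<open>\<forall>s\<in>V. edge_dist E e s = edge_dist E f s\<close> by metis
    moreover have "e \<subseteq> V" "f \<subseteq> V"
      using assms that by (auto simp: simple_graph_def)
    ultimately show ?thesis by blast
  qed
  then show ?thesis by (auto simp: edge_resolving_set_def)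
qed

end

theory Submission imports Defs "HOL-Library.FuncSet" begin

text \<open>Fix a resolving set \<open>S\<close> of \<open>k\<close> vertices. An edge is determined by its vector of distances
  to \<open>S\<close>, so a family of edges has at most as many members as there are vectors available to it
  (\<open>card_le_prod_of_resolved_edges\<close>). Every coordinate lies between \<open>0\<close> and \<open>D\<close>, which only gives
  about \<open>(D + 1) ^ k\<close>. The gain comes from treating edges close to \<open>S\<close> separately.

  If \<open>e\<close> is at distance \<open>i\<close> from \<open>s \<in> S\<close>, then both ends of \<open>e\<close> are within \<open>i + 1\<close> of \<open>s\<close>, and one of
  them is at distance \<open>i\<close>. By the triangle inequality the distance from \<open>e\<close> to any vertex \<open>t\<close> differs
  little from the constant \<open>graph_dist E s t\<close>: it exceeds it by at most \<open>i\<close> and falls short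
  of it by at most \<open>i + 1\<close> (\<open>edge_dist_near\<close>). This leaves \<open>2 * (i + 1)\<close> values for each coordinate
  \<open>t \<noteq> s\<close>, hence at most \<open>(2 * (i + 1)) ^ (k - 1)\<close> such edges.

  Apply this to all \<open>s \<in> S\<close> and all \<open>i < m\<close>, for a threshold \<open>m\<close>. The other edges have all
  their coordinates in \<open>{m..D}\<close>, so there are at most \<open>(D + 1 - m) ^ k\<close> of them. The choice
  \<open>m = \<lceil>D / 3\<rceil>\<close> turns \<open>D - m\<close> into \<open>\<lfloor>2 * D / 3\<rfloor>\<close>.\<close>

section \<open>Distances between vertices\<close>

lemma graph_dist_le_of_walk:
  "(u, v) \<in> adj E ^^ n \<Longrightarrow> graph_dist E u v \<le> n"
  unfolding graph_dist_def by (rule Least_le)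

lemma shortest_walk:
  assumes "connected_graph V E" "u \<in> V" "v \<in> V"
  shows "(u, v) \<in> adj E ^^ graph_dist E u v"
proof -
  obtain n where "(u, v) \<in> adj E ^^ n"
    using assms unfolding connected_graph_def by (meson rtrancl_imp_relpow)
  then show ?thesis
    unfolding graph_dist_def by (rule LeastI)
qed

lemma graph_dist_triangle:
  assumes "connected_graph V E" "u \<in> V" "v \<in> V" "w \<in> V"
  shows "graph_dist E u w \<le> graph_dist E u v + graph_dist E v w"
proof (rule graph_dist_le_of_walk)
  show "(u, w) \<in> adj E ^^ (graph_dist E u v + graph_dist E v w)"
    using shortest_walk[of V E u v] shortest_walk[of V E v w] assms
    by (auto simp: relpow_add)
qed

lemma walk_reverse: "(u, v) \<in> adj E ^^ n \<Longrightarrow> (v, u) \<in> adj E ^^ n"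
proof (induction n arbitrary: v)
  case (Suc n)
  then obtain w where "(u, w) \<in> adj E ^^ n" "(w, v) \<in> adj E" by auto
  then have "(v, w) \<in> adj E" "(w, u) \<in> adj E ^^ n"
    using Suc.IH by (auto simp: adj_def insert_commute)
  then show ?case by (rule relpow_Suc_I2)
qed simp

lemma graph_dist_sym: "graph_dist E u v = graph_dist E v u"
proof -
  have "(u, v) \<in> adj E ^^ n \<longleftrightarrow> (v, u) \<in> adj E ^^ n" for n
    using walk_reverse by metis
  then show ?thesis by (simp add: graph_dist_def)
qed

lemma graph_dist_le_diameter:
  assumes "simple_graph V E" "u \<in> V" "v \<in> V"
  shows "graph_dist E u v \<le> graph_diameter V E"
proof -
  have "{graph_dist E u v |u v. u \<in> V \<and> v \<in> V} = (\<lambda>(u, v). graph_dist E u v) ` (V \<times> V)"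
    by auto
  then have "finite {graph_dist E u v |u v. u \<in> V \<and> v \<in> V}"
    using assms by (simp add: simple_graph_def)
  then show ?thesis
    unfolding graph_diameter_def using assms by (auto intro!: Max_ge)
qed

section \<open>Distances from edges\<close>

lemma graph_dist_edge_ends:
  assumes "simple_graph V E" "e \<in> E" "x \<in> e" "y \<in> e"
  shows "graph_dist E x y \<le> 1"
proof (cases "x = y")
  case True
  then have "(x, y) \<in> adj E ^^ 0" by simp
  then show ?thesis using graph_dist_le_of_walk by fastforce
next
  case False
  have "card e = 2" using assms by (auto simp: simple_graph_def)
  with False assms have "e = {x, y}" by (auto simp: card_2_iff)
  then have "(x, y) \<in> adj E ^^ 1" using assms by (simp add: adj_def)
  then show ?thesis by (rule graph_dist_le_of_walk)
qed

lemma edge_subset_finite: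
  assumes "simple_graph V E" "e \<in> E"
  shows "e \<subseteq> V" "finite e" "e \<noteq> {}"
  using assms by (auto simp: simple_graph_def intro: card_ge_0_finite)

lemma nearest_end:
  assumes "simple_graph V E" "e \<in> E"
  obtains x where "x \<in> e" "x \<in> V" "edge_dist E e v = graph_dist E x v"
proof -
  have "edge_dist E e v \<in> (\<lambda>x. graph_dist E x v) ` e"
    unfolding edge_dist_def using edge_subset_finite[OF assms] by (intro Min_in) auto
  then show thesis using edge_subset_finite[OF assms] that by blast
qed

lemma edge_dist_le:
  assumes "simple_graph V E" "e \<in> E" "x \<in> e"
  shows "edge_dist E e v \<le> graph_dist E x v"
  unfolding edge_dist_def using edge_subset_finite[OF assms(1,2)] assms(3) by (intro Min_le) auto

lemma edge_dist_le_diameter: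
  assumes "simple_graph V E" "e \<in> E" "v \<in> V"
  shows "edge_dist E e v \<le> graph_diameter V E"
  using nearest_end[OF assms(1,2)] graph_dist_le_diameter assms by metis

text \<open>The two bounds are not symmetric because the end of \<open>e\<close> nearest to \<open>t\<close> may be the one
  farther from \<open>s\<close>, whereas for the upper bound the end nearest to \<open>s\<close> may be used. With
  truncated subtraction the interval can only become shorter.\<close>

lemma edge_dist_near:
  assumes G: "simple_graph V E" "connected_graph V E"
    and "e \<in> E" "s \<in> V" "t \<in> V"
  defines "i \<equiv> edge_dist E e s"
  shows "edge_dist E e t \<in> {graph_dist E s t - (i + 1)..graph_dist E s t + i}"
proof -
  obtain x where x: "x \<in> e" "x \<in> V" "i = graph_dist E x s"
    unfolding i_def using nearest_end[OF G(1) \<open>e \<in> E\<close>] by metis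
  obtain y where y: "y \<in> e" "y \<in> V" "edge_dist E e t = graph_dist E y t"
    using nearest_end[OF G(1) \<open>e \<in> E\<close>] by metis
  have "edge_dist E e t \<le> graph_dist E x t"
    using edge_dist_le G \<open>e \<in> E\<close> x by metis
  also have "\<dots> \<le> i + graph_dist E s t"
    using graph_dist_triangle[OF G(2)] x assms by metis
  finally have upper: "edge_dist E e t \<le> graph_dist E s t + i" by simp
  have "graph_dist E s t \<le> graph_dist E s x + graph_dist E x t"
    using graph_dist_triangle[OF G(2)] x assms by metis
  also have "\<dots> \<le> i + (graph_dist E x y + graph_dist E y t)"
    using graph_dist_triangle[OF G(2)] x y assms graph_dist_sym[of E s x] by simp
  also have "\<dots> \<le> i + (1 + edge_dist E e t)"
    using graph_dist_edge_ends[OF G(1) \<open>e \<in> E\<close> x(1) y(1)] y by simp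
  finally show ?thesis using upper by simp
qed

section \<open>Counting edges by their distance vectors\<close>

lemma edge_metric_dimension_attained:
  assumes "simple_graph V E" "connected_graph V E"
  obtains S where "edge_resolving_set V E S" "card S = edge_metric_dimension V E"
proof -
  have "{card S |S. edge_resolving_set V E S} \<subseteq> card ` Pow V"
    by (auto simp: edge_resolving_set_def)
  then have "finite {card S |S. edge_resolving_set V E S}"
    using assms by (meson finite_Pow_iff finite_imageI finite_subset simple_graph_def)
  moreover have "{card S |S. edge_resolving_set V E S} \<noteq> {}"
    using edge_resolving_set_vertices[OF assms] by blast
  ultimately have "edge_metric_dimension V E \<in> {card S |S. edge_resolving_set V E S}"
    unfolding edge_metric_dimension_def by (rule Min_in)
  then show thesis using that by auto
qed

lemma card_le_prod_of_resolved_edges: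
  assumes "edge_resolving_set V E S" "finite S" "F \<subseteq> E"
    and R: "\<And>t. t \<in> S \<Longrightarrow> finite (R t)"
    and val: "\<And>e t. e \<in> F \<Longrightarrow> t \<in> S \<Longrightarrow> edge_dist E e t \<in> R t"
  shows "card F \<le> (\<Prod>t\<in>S. card (R t))"
proof -
  let ?vec = "\<lambda>e. restrict (edge_dist E e) S"
  have "inj_on ?vec F"
  proof (rule inj_onI)
    fix e f assume "e \<in> F" "f \<in> F" and eq: "?vec e = ?vec f"
    have "edge_dist E e s = edge_dist E f s" if "s \<in> S" for s
      using fun_cong[OF eq, of s] that by simp
    then show "e = f"
      using assms(1,3) \<open>e \<in> F\<close> \<open>f \<in> F\<close> unfolding edge_resolving_set_def by blast
  qed
  moreover have "?vec ` F \<subseteq> Pi\<^sub>E S R" using val by auto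
  moreover have "finite (Pi\<^sub>E S R)" using assms(2) R by (rule finite_PiE)
  ultimately have "card F \<le> card (Pi\<^sub>E S R)" by (rule card_inj_on_le)
  then show ?thesis using assms(2) by (simp add: card_PiE)
qed

text \<open>The coordinate at \<open>s\<close> is fixed, which is why the exponent is \<open>card S - 1\<close>.\<close>

lemma card_edges_at_distance:
  assumes G: "simple_graph V E" "connected_graph V E"
    and S: "edge_resolving_set V E S" "finite S" "s \<in> S"
  shows "card {e\<in>E. edge_dist E e s = i} \<le> (2 * (i + 1)) ^ (card S - 1)"
proof -
  define R where "R t = (if t = s then {i}
    else {graph_dist E s t - (i + 1)..graph_dist E s t + i})" for t
  have SV: "S \<subseteq> V" using S by (simp add: edge_resolving_set_def)
  have "card {e\<in>E. edge_dist E e s = i} \<le> (\<Prod>t\<in>S. card (R t))"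
  proof (rule card_le_prod_of_resolved_edges[OF S(1,2)])
    fix e t assume "e \<in> {e\<in>E. edge_dist E e s = i}" "t \<in> S"
    then show "edge_dist E e t \<in> R t"
      using edge_dist_near[OF G, of e s t] SV S(3) by (auto simp: R_def)
  qed (auto simp: R_def)
  also have "\<dots> = (\<Prod>t\<in>S - {s}. card (R t))"
    using S by (simp add: prod.remove R_def)
  also have "\<dots> \<le> (\<Prod>t\<in>S - {s}. 2 * (i + 1))"
    by (rule prod_mono) (auto simp: R_def)
  also have "\<dots> = (2 * (i + 1)) ^ (card S - 1)"
    using S by simp
  finally show ?thesis .
qed

lemma card_edges_beyond:
  assumes G: "simple_graph V E"
    and S: "edge_resolving_set V E S" "finite S"
  shows "card {e\<in>E. \<forall>s\<in>S. m \<le> edge_dist E e s} \<le> (graph_diameter V E + 1 - m) ^ card S"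
proof -
  have "S \<subseteq> V" using S by (simp add: edge_resolving_set_def)
  then have "card {e\<in>E. \<forall>s\<in>S. m \<le> edge_dist E e s} \<le> (\<Prod>t\<in>S. card {m..graph_diameter V E})"
    using edge_dist_le_diameter[OF G] by (intro card_le_prod_of_resolved_edges[OF S]) auto
  then show ?thesis by simp
qed

lemma card_edges_threshold_bound:
  assumes G: "simple_graph V E" "connected_graph V E"
    and S: "edge_resolving_set V E S" "finite S"
  shows "card E \<le> (graph_diameter V E + 1 - m) ^ card S
    + card S * (\<Sum>i = 1..m. (2 * i) ^ (card S - 1))"
proof -
  let ?far = "{e\<in>E. \<forall>s\<in>S. m \<le> edge_dist E e s}"
  let ?near = "\<lambda>s i. {e\<in>E. edge_dist E e s = i}"
  have "E = ?far \<union> (\<Union>s\<in>S. \<Union>i<m. ?near s i)" by force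
  then have "card E \<le> card ?far + card (\<Union>s\<in>S. \<Union>i<m. ?near s i)"
    by (metis (no_types, lifting) card_Un_le)
  also have "card (\<Union>s\<in>S. \<Union>i<m. ?near s i) \<le> (\<Sum>s\<in>S. card (\<Union>i<m. ?near s i))"
    using S(2) by (rule card_UN_le)
  also have "\<dots> \<le> (\<Sum>s\<in>S. \<Sum>i<m. card (?near s i))"
    by (intro sum_mono card_UN_le) simp
  also have "\<dots> \<le> (\<Sum>s\<in>S. \<Sum>i<m. (2 * (i + 1)) ^ (card S - 1))"
    using card_edges_at_distance[OF G S] by (intro sum_mono) auto
  also have "\<dots> = card S * (\<Sum>i<m. (2 * (i + 1)) ^ (card S - 1))" by simp
  also have "(\<Sum>i<m. (2 * (i + 1)) ^ (card S - 1)) = (\<Sum>i = 1..m. (2 * i) ^ (card S - 1))"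
    by (rule sum.reindex_bij_witness[of _ "\<lambda>i. i - 1" Suc]) auto
  finally show ?thesis
    using card_edges_beyond[OF G(1) S, of m] by linarith
qed

section \<open>The bound on the number of edges\<close>

theorem theorem2p1:
  fixes V :: "'a set" and E :: "'a set set" and D k :: nat
  assumes "simple_graph V E"
    and "connected_graph V E"
    and "graph_diameter V E = D"
    and "edge_metric_dimension V E = k"
  shows "card E \<le> (nat \<lfloor>2 * real D / 3\<rfloor> + 1) ^ k
           + k * (\<Sum>i = 1..nat \<lceil>real D / 3\<rceil>. (2 * i) ^ (k - 1))"
proof -
  obtain S where S: "edge_resolving_set V E S" "card S = k"
    using edge_metric_dimension_attained[OF assms(1,2)] assms(4) by metis
  have "finite S"
    using S(1) assms(1) finite_subset by (auto simp: edge_resolving_set_def simple_graph_def)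
  have "\<lfloor>2 * real D / 3\<rfloor> = int D - \<lceil>real D / 3\<rceil>" "0 \<le> \<lceil>real D / 3\<rceil>" "\<lceil>real D / 3\<rceil> \<le> int D"
    by linarith+
  then have "nat \<lfloor>2 * real D / 3\<rfloor> + 1 = D + 1 - nat \<lceil>real D / 3\<rceil>"
    by linarith
  then show ?thesis
    using card_edges_threshold_bound[OF assms(1,2) S(1) \<open>finite S\<close>, of "nat \<lceil>real D / 3\<rceil>"]
      S(2) assms(3) by simp
qed

end
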